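(* Let $q(\cdot)\in C^2([t_1-\tau,t_2];\mathbb{R}^n)$ be a normal extremizer of the isoperimetric variational problem with time delay: extremize $$J^{\tau}[q(\cdot)]=\int_{t_1}^{t_2}L[q]_\tau(t)\,dt$$ subject to $I^{\tau}[q(\cdot)]=\int_{t_1}^{t_2}g[q]_\tau(t)\,dt=l$ and to the boundary conditions $q(t)=\delta(t)$ for $t\in[t_1-\tau,t_1]$, $q(t_2)=q_{t_2}$. Then there exists $\lambda\in\mathbb{R}$ such that, with $F:=L-\lambda g$, the function $q$ satisfies the isoperimetric Euler--Lagrange equations with time delay $$\frac{d}{dt}\left\{\partial_3F[q]_\tau(t)+\partial_5F[q]_\tau(t+\tau)\right\}=\partial_2F[q]_\tau(t)+\partial_4F[q]_\tau(t+\tau),\qquad t_1\le t\le t_2-\tau,$$ $$\frac{d}{dt}\partial_3F[q]_\tau(t)=\partial_2F[q]_\tau(t),\qquad t_2-\tau<t\le t_2 .$$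
   Context: Fixed data: real numbers $t_1<t_2$, a delay $\tau$ with $0<\tau<t_2-t_1$, $n\in\mathbb{N}$, a piecewise smooth function $\delta:[t_1-\tau,t_1]\to\mathbb{R}^n$, a point $q_{t_2}\in\mathbb{R}^n$, and a constant $l\in\mathbb{R}$. The functions $L,g:[t_1,t_2]\times(\mathbb{R}^n)^4\to\mathbb{R}$ are of class $C^1$. Notation: $\dot q=dq/dt$; $[q]_\tau(t):=(t,q(t),\dot q(t),q(t-\tau),\dot q(t-\tau))$; for a function $G$ on $[t_1,t_2]\times(\mathbb{R}^n)^4$, $G[q]_\tau(t):=G([q]_\tau(t))$, and $\partial_iG$ ($i=1,\dots,5$) is the partial derivative (gradient) with respect to the $i$-th argument (argument 1 is in $\mathbb{R}$, arguments 2--5 are in $\mathbb{R}^n$), so $\partial_iG[q]_\tau(t+\tau)$ means $\partial_iG$ evaluated at $[q]_\tau(t+\tau)$. Admissible functions are the $C^2$ functions on $[t_1-\tau,t_2]$ satisfying the boundary conditions and the constraint $I^\tau[q]=l$. An extremizer is an admissible function that is a local minimizer or a local maximizer of $J^\tau$ among admissible functions (local in the sense of a weak extremum, i.e. with respect to the $C^1$ norm). An extremizer $q$ is called abnormal if it satisfies the Euler--Lagrange equations with time delay for $g$, i.e. $$\frac{d}{dt}\left\{\partial_3g[q]_\tau(t)+\partial_5g[q]_\tau(t+\tau)\right\}=\partial_2g[q]_\tau(t)+\partial_4g[q]_\tau(t+\tau)\quad (t_1\le t\le t_2-\tau),$$ $$\frac{d}{dt}\partial_3g[q]_\tau(t)=\partial_2g[q]_\tau(t)\quad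 (t_2-\tau<t\le t_2);$$ otherwise it is called normal. *)

theory Defs
  imports "HOL-Analysis.Analysis"
begin

text \<open>The \<open>n\<close>-dimensional space is \<open>real ^ 'n\<close>. A function on
  \<open>[t1, t2] \<times> (\<real>\<^sup>n)\<^sup>4\<close> is a total function on the product type below of which only the
  values with first component in \<open>{t1..t2}\<close> are ever used.\<close>

type_synonym 'n args =
  "real \<times> (real ^ 'n) \<times> (real ^ 'n) \<times> (real ^ 'n) \<times> (real ^ 'n)"

text \<open>Derivatives are taken within the set, hence one-sided at the boundary of a closed interval.\<close>

definition C1_on :: "('a::real_normed_vector \<Rightarrow> real) \<Rightarrow> 'a set \<Rightarrow> bool" where
  "C1_on G S \<longleftrightarrow>
     (\<exists>G' :: 'a \<Rightarrow> 'a \<Rightarrow>\<^sub>L real.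
        (\<forall>x\<in>S. (G has_derivative blinfun_apply (G' x)) (at x within S)) \<and> continuous_on S G')"

definition C2_on :: "(real \<Rightarrow> 'a::real_normed_vector) \<Rightarrow> real set \<Rightarrow> bool" where
  "C2_on q S \<longleftrightarrow>
     (\<exists>q' q''. (\<forall>t\<in>S. (q has_vector_derivative q' t) (at t within S)) \<and>
               (\<forall>t\<in>S. (q' has_vector_derivative q'' t) (at t within S)) \<and>
               continuous_on S q'')"

definition C1_norm_on :: "real set \<Rightarrow> (real \<Rightarrow> 'a::real_normed_vector) \<Rightarrow> real" where
  "C1_norm_on S f =
     (SUP t\<in>S. norm (f t)) + (SUP t\<in>S. norm (vector_derivative f (at t within S)))"

definition gradient :: "('a::real_inner \<Rightarrow> real) \<Rightarrow> 'a \<Rightarrow> 'a" where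
  "gradient f x = (THE D. GDERIV f x :> D)"

fun partial2 :: "('n args \<Rightarrow> real) \<Rightarrow> 'n::finite args \<Rightarrow> real ^ 'n" where
  "partial2 G (t, x, v, y, w) = gradient (\<lambda>z. G (t, z, v, y, w)) x"

fun partial3 :: "('n args \<Rightarrow> real) \<Rightarrow> 'n::finite args \<Rightarrow> real ^ 'n" where
  "partial3 G (t, x, v, y, w) = gradient (\<lambda>z. G (t, x, z, y, w)) v"

fun partial4 :: "('n args \<Rightarrow> real) \<Rightarrow> 'n::finite args \<Rightarrow> real ^ 'n" where
  "partial4 G (t, x, v, y, w) = gradient (\<lambda>z. G (t, x, v, z, w)) y"

fun partial5 :: "('n args \<Rightarrow> real) \<Rightarrow> 'n::finite args \<Rightarrow> real ^ 'n" where
  "partial5 G (t, x, v, y, w) = gradient (\<lambda>z. G (t, x, v, y, z)) w"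

text \<open>\<open>[q]\<^sub>\<tau>(t)\<close>; since \<open>q\<close> lives on \<open>[t1 - \<tau>, t2]\<close>, its derivative is taken within
  that interval.\<close>

definition delayed ::
  "real \<Rightarrow> real \<Rightarrow> real \<Rightarrow> (real \<Rightarrow> real ^ 'n) \<Rightarrow> real \<Rightarrow> 'n::finite args" where
  "delayed t1 t2 \<tau> q t =
     (let dq = (\<lambda>s. vector_derivative q (at s within {t1 - \<tau>..t2}))
      in (t, q t, dq t, q (t - \<tau>), dq (t - \<tau>)))"

definition delayed_integral ::
  "real \<Rightarrow> real \<Rightarrow> real \<Rightarrow> ('n::finite args \<Rightarrow> real) \<Rightarrow> (real \<Rightarrow> real ^ 'n) \<Rightarrow> real" where
  "delayed_integral t1 t2 \<tau> G q = integral {t1..t2} (\<lambda>t. G (delayed t1 t2 \<tau> q t))"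

text \<open>The existence of the derivatives \<open>d/dt\<close> is part of the equations. In the first one the
  differentiated function only makes sense on \<open>[t1, t2 - \<tau>]\<close>, so at \<open>t1\<close> and \<open>t2 - \<tau>\<close> the
  derivative is one-sided; likewise at \<open>t2\<close> in the second one.\<close>

definition delayed_Euler_Lagrange ::
  "real \<Rightarrow> real \<Rightarrow> real \<Rightarrow> ('n::finite args \<Rightarrow> real) \<Rightarrow> (real \<Rightarrow> real ^ 'n) \<Rightarrow> bool" where
  "delayed_Euler_Lagrange t1 t2 \<tau> G q \<longleftrightarrow>
     (\<forall>t\<in>{t1..t2 - \<tau>}.
        ((\<lambda>s. partial3 G (delayed t1 t2 \<tau> q s) + partial5 G (delayed t1 t2 \<tau> q (s + \<tau>)))
           has_vector_derivative
           (partial2 G (delayed t1 t2 \<tau> q t) + partial4 G (delayed t1 t2 \<tau> q (t + \<tau>))))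
        (at t within {t1..t2 - \<tau>})) \<and>
     (\<forall>t\<in>{t2 - \<tau><..t2}.
        ((\<lambda>s. partial3 G (delayed t1 t2 \<tau> q s))
           has_vector_derivative partial2 G (delayed t1 t2 \<tau> q t))
        (at t within {t2 - \<tau><..t2}))"

definition admissible ::
  "real \<Rightarrow> real \<Rightarrow> real \<Rightarrow> (real \<Rightarrow> real ^ 'n) \<Rightarrow> real ^ 'n \<Rightarrow> ('n::finite args \<Rightarrow> real) \<Rightarrow> real \<Rightarrow>
   (real \<Rightarrow> real ^ 'n) \<Rightarrow> bool" where
  "admissible t1 t2 \<tau> \<delta> qt2 g l q \<longleftrightarrow>
     C2_on q {t1 - \<tau>..t2} \<and>
     (\<forall>t\<in>{t1 - \<tau>..t1}. q t = \<delta> t) \<and> q t2 = qt2 \<and>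
     delayed_integral t1 t2 \<tau> g q = l"

definition local_minimizer ::
  "real \<Rightarrow> real \<Rightarrow> real \<Rightarrow> (real \<Rightarrow> real ^ 'n) \<Rightarrow> real ^ 'n \<Rightarrow> ('n::finite args \<Rightarrow> real) \<Rightarrow>
   ('n args \<Rightarrow> real) \<Rightarrow> real \<Rightarrow> (real \<Rightarrow> real ^ 'n) \<Rightarrow> bool" where
  "local_minimizer t1 t2 \<tau> \<delta> qt2 L g l q \<longleftrightarrow>
     admissible t1 t2 \<tau> \<delta> qt2 g l q \<and>
     (\<exists>\<epsilon>>0. \<forall>p. admissible t1 t2 \<tau> \<delta> qt2 g l p \<and>
                 C1_norm_on {t1 - \<tau>..t2} (\<lambda>t. p t - q t) < \<epsilon> \<longrightarrow>
                 delayed_integral t1 t2 \<tau> L q \<le> delayed_integral t1 t2 \<tau> L p)"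

definition local_maximizer ::
  "real \<Rightarrow> real \<Rightarrow> real \<Rightarrow> (real \<Rightarrow> real ^ 'n) \<Rightarrow> real ^ 'n \<Rightarrow> ('n::finite args \<Rightarrow> real) \<Rightarrow>
   ('n args \<Rightarrow> real) \<Rightarrow> real \<Rightarrow> (real \<Rightarrow> real ^ 'n) \<Rightarrow> bool" where
  "local_maximizer t1 t2 \<tau> \<delta> qt2 L g l q \<longleftrightarrow>
     admissible t1 t2 \<tau> \<delta> qt2 g l q \<and>
     (\<exists>\<epsilon>>0. \<forall>p. admissible t1 t2 \<tau> \<delta> qt2 g l p \<and>
                 C1_norm_on {t1 - \<tau>..t2} (\<lambda>t. p t - q t) < \<epsilon> \<longrightarrow>
                 delayed_integral t1 t2 \<tau> L p \<le> delayed_integral t1 t2 \<tau> L q)"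

definition extremizer ::
  "real \<Rightarrow> real \<Rightarrow> real \<Rightarrow> (real \<Rightarrow> real ^ 'n) \<Rightarrow> real ^ 'n \<Rightarrow> ('n::finite args \<Rightarrow> real) \<Rightarrow>
   ('n args \<Rightarrow> real) \<Rightarrow> real \<Rightarrow> (real \<Rightarrow> real ^ 'n) \<Rightarrow> bool" where
  "extremizer t1 t2 \<tau> \<delta> qt2 L g l q \<longleftrightarrow>
     local_minimizer t1 t2 \<tau> \<delta> qt2 L g l q \<or> local_maximizer t1 t2 \<tau> \<delta> qt2 L g l q"

definition abnormal_extremizer ::
  "real \<Rightarrow> real \<Rightarrow> real \<Rightarrow> (real \<Rightarrow> real ^ 'n) \<Rightarrow> real ^ 'n \<Rightarrow> ('n::finite args \<Rightarrow> real) \<Rightarrow>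
   ('n args \<Rightarrow> real) \<Rightarrow> real \<Rightarrow> (real \<Rightarrow> real ^ 'n) \<Rightarrow> bool" where
  "abnormal_extremizer t1 t2 \<tau> \<delta> qt2 L g l q \<longleftrightarrow>
     extremizer t1 t2 \<tau> \<delta> qt2 L g l q \<and> delayed_Euler_Lagrange t1 t2 \<tau> g q"

definition normal_extremizer ::
  "real \<Rightarrow> real \<Rightarrow> real \<Rightarrow> (real \<Rightarrow> real ^ 'n) \<Rightarrow> real ^ 'n \<Rightarrow> ('n::finite args \<Rightarrow> real) \<Rightarrow>
   ('n args \<Rightarrow> real) \<Rightarrow> real \<Rightarrow> (real \<Rightarrow> real ^ 'n) \<Rightarrow> bool" where
  "normal_extremizer t1 t2 \<tau> \<delta> qt2 L g l q \<longleftrightarrow>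
     extremizer t1 t2 \<tau> \<delta> qt2 L g l q \<and> \<not> abnormal_extremizer t1 t2 \<tau> \<delta> qt2 L g l q"

end

theory Submission imports Defs begin

text \<open>
  The argument is the classical one for isoperimetric problems: a first variation, a Lagrange
  multiplier, and the lemma of du Bois-Reymond. Below, \<open>J\<close> is the cost functional.

  Variations are taken along \<open>C\<^sup>2\<close> functions \<open>h\<close> on the real line that vanish outside the open
  interval between \<open>t1\<close> and \<open>t2\<close>; adding such a function to \<open>q\<close> keeps the initial history, the end
  value and the regularity. For two variations \<open>h\<close>, \<open>k\<close>, the map sending \<open>(a, b)\<close> to the pair of the
  values of the cost and of the constraint functional at \<open>q + a h + b k\<close> is continuous on the plane,
  and its derivative at the origin is the matrix of first variations
  (\<open>delayed_integral_perturbation\<close>). If that matrix were invertible, the image of every small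
  disc would be a neighbourhood of \<open>(J q, l)\<close>. The disc would then contain parameters that keep the
  constraint value \<open>l\<close> and make the cost larger, and others that make it smaller, so that \<open>q\<close> would
  be neither a local minimizer nor a local maximizer. So the determinant vanishes
  (\<open>first_variations_proportional\<close>). Only the derivative at one point and continuity enter,
  through Sussmann's open mapping lemma, so no implicit function theorem is involved.

  If all first variations of an integrand \<open>G\<close> at \<open>q\<close> vanish, then the delayed Euler-Lagrange equations
  hold for \<open>G\<close> (\<open>vanishing_first_variation_imp_Euler_Lagrange\<close>). Variations supported in
  \<open>[t1, t2 - \<tau>]\<close> are seen both directly and, after the substitution \<open>t \<mapsto> t + \<tau>\<close>, through the delayed
  arguments; they give the first equation. Variations supported in \<open>[t2 - \<tau>, t2]\<close> are never seen
  through the delayed arguments; they give the second. In both cases the derivative of the bracket in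
  the equation is supplied by \<open>du_Bois_Reymond\<close>, since no second derivatives of the
  integrand are available.

  If \<open>q\<close> is normal, the equations for \<open>g\<close> fail, so some variation \<open>k\<close> has a nonzero first variation of \<open>g\<close>.
  The multiplier is the quotient of the first variations of \<open>L\<close> and \<open>g\<close> along this \<open>k\<close>; by the vanishing
  determinant every first variation of \<open>L - \<lambda> g\<close> is then zero.
\<close>

section \<open>Variations with compact support\<close>

text \<open>The derivative \<open>h'\<close> is carried along as an argument so that no derivative operator is needed.
  Differentiability on the whole line together with vanishing outside the open interval means that
  \<open>h\<close>, \<open>h'\<close> and \<open>h''\<close> are zero at both end points; so a variation of a subinterval is also one of the
  full interval, and it glues \<open>C\<^sup>2\<close>-smoothly to the fixed history.\<close>
definition variation_on ::
  "real \<Rightarrow> real \<Rightarrow> (real \<Rightarrow> 'a::real_normed_vector) \<Rightarrow> (real \<Rightarrow> 'a) \<Rightarrow> bool" where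
  "variation_on a b h h' \<longleftrightarrow>
     (\<exists>h''. (\<forall>t. (h has_vector_derivative h' t) (at t)) \<and>
            (\<forall>t. (h' has_vector_derivative h'' t) (at t)) \<and> continuous_on UNIV h'') \<and>
     (\<forall>t. t \<notin> {a<..<b} \<longrightarrow> h t = 0 \<and> h' t = 0)"

lemma variation_continuous:
  assumes "variation_on a b h h'"
  shows "continuous_on S h" "continuous_on S h'"
  using assms unfolding variation_on_def
  by (meson continuous_at_imp_continuous_on has_vector_derivative_continuous)+

lemma variation_on_scaleR:
  assumes "variation_on c d \<eta> \<eta>'" "a \<le> c" "d \<le> b"
  shows "variation_on a b (\<lambda>t. \<eta> t *\<^sub>R v) (\<lambda>t. \<eta>' t *\<^sub>R v)"
proof -
  from assms(1) obtain \<eta>'' where d: "\<And>t. (\<eta> has_vector_derivative \<eta>' t) (at t)"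
      "\<And>t. (\<eta>' has_vector_derivative \<eta>'' t) (at t)" "continuous_on UNIV \<eta>''"
    and out: "\<And>t. t \<notin> {c<..<d} \<Longrightarrow> \<eta> t = 0 \<and> \<eta>' t = 0"
    unfolding variation_on_def by blast
  show ?thesis
    unfolding variation_on_def
  proof (intro conjI exI[of _ "\<lambda>t. \<eta>'' t *\<^sub>R v"] allI impI)
    show "continuous_on UNIV (\<lambda>t. \<eta>'' t *\<^sub>R v)" by (intro continuous_intros d(3))
    fix t
    show "((\<lambda>t. \<eta> t *\<^sub>R v) has_vector_derivative \<eta>' t *\<^sub>R v) (at t)"
      using bounded_linear.has_vector_derivative[OF bounded_linear_scaleR_left d(1)] .
    show "((\<lambda>t. \<eta>' t *\<^sub>R v) has_vector_derivative \<eta>'' t *\<^sub>R v) (at t)"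
      using bounded_linear.has_vector_derivative[OF bounded_linear_scaleR_left d(2)] .
  next
    fix t assume "t \<notin> {a<..<b}"
    then have "t \<notin> {c<..<d}" using assms by auto
    then show "\<eta> t *\<^sub>R v = 0" "\<eta>' t *\<^sub>R v = 0" using out by auto
  qed
qed

section \<open>The lemma of du Bois-Reymond\<close>

text \<open>At the origin the difference quotient of the squared positive part is the positive part itself.\<close>
lemma max_power2_deriv:
  "((\<lambda>y::real. (max 0 y)\<^sup>2) has_real_derivative 2 * max 0 x) (at x)"
proof -
  consider "x > 0" | "x < 0" | "x = 0" by linarith
  then show ?thesis
  proof cases
    case 1
    have "((\<lambda>y::real. y\<^sup>2) has_real_derivative 2 * max 0 x) (at x)"
      using 1 by (auto intro!: derivative_eq_intros)
    then show ?thesis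
      by (rule has_field_derivative_transform_within_open[of _ _ _ "{0<..}"]) (use 1 in auto)
  next
    case 2
    have "((\<lambda>y::real. 0) has_real_derivative 2 * max 0 x) (at x)"
      using 2 by simp
    then show ?thesis
      by (rule has_field_derivative_transform_within_open[of _ _ _ "{..<0}"]) (use 2 in auto)
  next
    case 3
    have "((\<lambda>h::real. max 0 h) \<longlongrightarrow> max 0 0) (at 0)"
      by (intro tendsto_intros)
    then have "((\<lambda>h::real. max 0 h) \<longlongrightarrow> 0) (at 0)"
      by simp
    then have "((\<lambda>h::real. (max 0 h)\<^sup>2 / h) \<longlongrightarrow> 0) (at 0)"
      by (rule Lim_transform_eventually[where f = "\<lambda>h. max 0 h"])
         (auto simp: eventually_at_filter max_def power2_eq_square)
    then show ?thesis
      using 3 by (simp add: DERIV_def)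
  qed
qed

text \<open>A \<open>C\<^sup>1\<close> bump supported in \<open>[-e, e]\<close>; the square makes the positive part differentiable.\<close>
definition bump :: "real \<Rightarrow> real \<Rightarrow> real" where
  "bump e x = (max 0 (e\<^sup>2 - x\<^sup>2))\<^sup>2"

lemma bump_deriv: "(bump e has_real_derivative - 4 * x * max 0 (e\<^sup>2 - x\<^sup>2)) (at x)"
proof -
  have "((\<lambda>x. e\<^sup>2 - x\<^sup>2) has_real_derivative - 2 * x) (at x)"
    by (auto intro!: derivative_eq_intros)
  from DERIV_chain2[OF max_power2_deriv this] show ?thesis
    unfolding bump_def[abs_def] by (simp add: mult_ac)
qed

lemma bump_nonneg: "bump e x \<ge> 0"
  by (simp add: bump_def)

lemma bump_eq_0: "e > 0 \<Longrightarrow> \<bar>x\<bar> \<ge> e \<Longrightarrow> bump e x = 0"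
  unfolding bump_def using power_mono[of e "\<bar>x\<bar>" 2] by (simp add: max_def)

lemma bump_0: "e > 0 \<Longrightarrow> bump e 0 > 0"
  by (simp add: bump_def)

text \<open>An antiderivative of a bump is constant on either side of the support.\<close>
lemma bump_antiderivative:
  assumes "e > 0"
  obtains F c1 c2 where "\<And>x. (F has_real_derivative bump e x) (at x)"
    "\<And>x. x \<le> - e \<Longrightarrow> F x = c1" "\<And>x. x \<ge> e \<Longrightarrow> F x = c2"
proof -
  have "isCont (bump e) x" for x
    using bump_deriv DERIV_isCont by blast
  then obtain F where "\<And>x. (F has_vector_derivative bump e x) (at x)"
    using einterval_antiderivative[of "-\<infinity>" "\<infinity>" "bump e"] by auto
  then have F: "\<And>x. (F has_real_derivative bump e x) (at x)"
    by (simp add: has_real_derivative_iff_has_vector_derivative)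
  have "(F has_real_derivative 0) (at x within S)" if "\<bar>x\<bar> \<ge> e" for x S
    using F[of x] bump_eq_0[OF assms that] by (simp add: has_field_derivative_at_within)
  then have "\<exists>c. \<forall>x\<in>{..-e}. F x = c" "\<exists>c. \<forall>x\<in>{e..}. F x = c"
    by (intro has_field_derivative_zero_constant; auto)+
  then show ?thesis using F that by fastforce
qed

text \<open>For an antiderivative \<open>F\<close> of the bump, \<open>F (t - s) - F (t - u)\<close> vanishes on both sides of the
  supports, because the two translates have the same constant value there. Thus a difference of two
  translated bumps is the derivative of a variation.\<close>
lemma two_bump_variation:
  assumes "e > 0" "a < s - e" "s + e < b" "a < u - e" "u + e < b"
  obtains \<eta> where "variation_on a b \<eta> (\<lambda>t. bump e (t - s) - bump e (t - u))"
proof -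
  obtain F c1 c2 where F: "\<And>x. (F has_real_derivative bump e x) (at x)"
    "\<And>x. x \<le> - e \<Longrightarrow> F x = c1" "\<And>x. x \<ge> e \<Longrightarrow> F x = c2"
    using bump_antiderivative[OF assms(1)] by metis
  let ?d = "\<lambda>x. - 4 * x * max 0 (e\<^sup>2 - x\<^sup>2)"
  have "variation_on a b (\<lambda>t. F (t - s) - F (t - u)) (\<lambda>t. bump e (t - s) - bump e (t - u))"
    unfolding variation_on_def
  proof (intro conjI exI[of _ "\<lambda>t. ?d (t - s) - ?d (t - u)"] allI impI)
    fix t
    show "((\<lambda>t. F (t - s) - F (t - u)) has_vector_derivative
        bump e (t - s) - bump e (t - u)) (at t)"
      unfolding has_real_derivative_iff_has_vector_derivative[symmetric]
      by (auto intro!: derivative_eq_intros DERIV_chain2[OF F(1)])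
    show "((\<lambda>t. bump e (t - s) - bump e (t - u)) has_vector_derivative
        ?d (t - s) - ?d (t - u)) (at t)"
      unfolding has_real_derivative_iff_has_vector_derivative[symmetric]
      by (rule derivative_eq_intros DERIV_chain2[OF bump_deriv] | simp)+
  next
    show "continuous_on UNIV (\<lambda>t. ?d (t - s) - ?d (t - u))"
      by (intro continuous_intros)
  next
    fix t assume "t \<notin> {a<..<b}"
    then have "t \<le> a \<or> t \<ge> b" by auto
    then show "F (t - s) - F (t - u) = 0"
      using assms F(2)[of "t - s"] F(2)[of "t - u"] F(3)[of "t - s"] F(3)[of "t - u"] by auto
    show "bump e (t - s) - bump e (t - u) = 0"
      using assms \<open>t \<le> a \<or> t \<ge> b\<close> by (auto simp: bump_eq_0)
  qed
  then show ?thesis using that by blast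
qed

text \<open>If \<open>\<gamma> s < m < \<gamma> u\<close>, a variation whose derivative is a narrow bump at \<open>s\<close> minus a narrow bump at \<open>u\<close>
  would give a strictly negative integral against \<open>\<gamma> - m\<close>, while the constant \<open>m\<close> contributes
  nothing. So \<open>\<gamma>\<close> takes a single value in the open interval, and by continuity on its closure.\<close>
lemma du_Bois_Reymond_constant:
  fixes \<gamma> :: "real \<Rightarrow> real"
  assumes "a < b" and cont: "continuous_on {a..b} \<gamma>"
    and zero: "\<And>\<eta> \<eta>'. variation_on a b \<eta> \<eta>' \<Longrightarrow> integral {a..b} (\<lambda>t. \<eta>' t * \<gamma> t) = 0"
  shows "\<exists>c. \<forall>t\<in>{a..b}. \<gamma> t = c"
proof -
  have not_less: "\<not> \<gamma> s < \<gamma> u" if s: "s \<in> {a<..<b}" and u: "u \<in> {a<..<b}" for s u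
  proof
    assume "\<gamma> s < \<gamma> u"
    define m where "m = (\<gamma> s + \<gamma> u) / 2"
    have m: "\<gamma> s < m" "m < \<gamma> u" using \<open>\<gamma> s < \<gamma> u\<close> by (auto simp: m_def)
    have isC: "isCont \<gamma> x" if "x \<in> {a<..<b}" for x
      using that continuous_on_interior[OF cont, of x] by simp
    have "\<forall>\<^sub>F x in at s. \<gamma> x < m" "\<forall>\<^sub>F x in at u. m < \<gamma> x"
      using order_tendstoD[OF isC[OF s, unfolded isCont_def]]
        order_tendstoD[OF isC[OF u, unfolded isCont_def]] m by auto
    then obtain d1 d2 where d: "d1 > 0" "\<And>x. dist x s < d1 \<Longrightarrow> \<gamma> x < m"
        "d2 > 0" "\<And>x. dist x u < d2 \<Longrightarrow> m < \<gamma> x"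
      unfolding eventually_at using m by (metis UNIV_I)
    \<comment> \<open>Half of the minimum makes the bumps fit strictly inside the interval and the two
      neighbourhoods on which \<open>\<gamma>\<close> stays on its side of \<open>m\<close>.\<close>
    define e where "e = Min {d1, d2, s - a, b - s, u - a, b - u} / 2"
    have "e > 0" using d s u by (auto simp: e_def)
    have "2 * e \<le> d1" "2 * e \<le> d2" "2 * e \<le> s - a" "2 * e \<le> b - s" "2 * e \<le> u - a" "2 * e \<le> b - u"
      by (auto simp: e_def)
    then have e: "e < d1" "e < d2" "a < s - e" "s + e < b" "a < u - e" "u + e < b"
      using \<open>e > 0\<close> by linarith+
    let ?\<psi> = "\<lambda>t. bump e (t - s) - bump e (t - u)"
    obtain \<eta> where v: "variation_on a b \<eta> ?\<psi>"
      using two_bump_variation[OF \<open>e > 0\<close> e(3-6)] by blast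
    have c\<psi>: "continuous_on {a..b} ?\<psi>" by (rule variation_continuous[OF v])
    have "(?\<psi> has_integral (\<eta> b - \<eta> a)) {a..b}"
      by (rule fundamental_theorem_of_calculus)
         (use v \<open>a < b\<close> in \<open>auto simp: variation_on_def intro: has_vector_derivative_at_within\<close>)
    moreover have "\<eta> a = 0" "\<eta> b = 0" using v by (auto simp: variation_on_def)
    ultimately have "integral {a..b} ?\<psi> = 0" by (simp add: integral_unique)
    then have "integral {a..b} (\<lambda>t. m * ?\<psi> t - ?\<psi> t * \<gamma> t) = 0"
      using zero[OF v] c\<psi> cont
      by (subst integral_diff) (auto intro!: integrable_continuous_real continuous_intros)
    \<comment> \<open>Where the first bump is nonzero \<open>\<gamma>\<close> is below \<open>m\<close>; where the second is, above.\<close>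
    moreover have "m * ?\<psi> t - ?\<psi> t * \<gamma> t \<ge> 0" for t
    proof -
      have "bump e (t - s) * (m - \<gamma> t) \<ge> 0"
      proof (cases "\<bar>t - s\<bar> < e")
        case True
        then show ?thesis using d(2)[of t] e(1) bump_nonneg[of e "t - s"] by (simp add: dist_real_def)
      next
        case False
        then show ?thesis using \<open>e > 0\<close> by (simp add: bump_eq_0)
      qed
      moreover have "bump e (t - u) * (\<gamma> t - m) \<ge> 0"
      proof (cases "\<bar>t - u\<bar> < e")
        case True
        then show ?thesis using d(4)[of t] e(2) bump_nonneg[of e "t - u"] by (simp add: dist_real_def)
      next
        case False
        then show ?thesis using \<open>e > 0\<close> by (simp add: bump_eq_0)
      qed
      ultimately show ?thesis by (simp add: algebra_simps)
    qed
    ultimately have "\<forall>t\<in>{a..b}. m * ?\<psi> t - ?\<psi> t * \<gamma> t = 0"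
      using c\<psi> cont \<open>a < b\<close>
      by (subst (asm) integral_eq_0_iff) (auto intro!: continuous_intros)
    then have "m * ?\<psi> s - ?\<psi> s * \<gamma> s = 0"
      by (rule bspec) (use s in auto)
    then have "(m - \<gamma> s) * ?\<psi> s = 0"
      by (simp only: left_diff_distrib mult.commute[of "\<gamma> s"])
    then have "?\<psi> s = 0" using m by simp
    \<comment> \<open>The second bump does not reach \<open>s\<close>, because \<open>\<gamma> s < m\<close>.\<close>
    moreover have "dist s u \<ge> d2"
      using d(4)[of s] m by (intro leI notI) simp
    then have "bump e (s - u) = 0"
      using e(2) \<open>e > 0\<close> by (intro bump_eq_0) (simp_all add: dist_real_def)
    ultimately show False using bump_0[OF \<open>e > 0\<close>] by simp
  qed
  let ?c = "\<gamma> ((a + b) / 2)"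
  have mid: "(a + b) / 2 \<in> {a<..<b}" using \<open>a < b\<close> by auto
  have inner: "\<gamma> t = ?c" if "t \<in> {a<..<b}" for t
    using not_less[OF that mid] not_less[OF mid that] by linarith
  have closure: "closure {a<..<b} = {a..b}"
    using \<open>a < b\<close> by (rule closure_greaterThanLessThan)
  have "\<gamma> t = ?c" if "t \<in> {a..b}" for t
    by (rule continuous_constant_on_closure[of "{a<..<b}", unfolded closure, OF cont inner that])
  then show ?thesis by blast
qed

text \<open>Integrating \<open>A\<close> by parts against the variation turns the hypothesis into the orthogonality of
  \<open>B - \<integral>A\<close> to all derivatives of variations; hence that difference is constant and \<open>B\<close> inherits the
  derivative of \<open>\<integral>A\<close>. This yields differentiability of \<open>B\<close>, of which only continuity was known.\<close>
lemma du_Bois_Reymond: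
  fixes A B :: "real \<Rightarrow> 'a::euclidean_space"
  assumes "a < b" and A: "continuous_on {a..b} A" and B: "continuous_on {a..b} B"
    and zero: "\<And>\<eta> \<eta>' v. variation_on a b \<eta> \<eta>' \<Longrightarrow>
      integral {a..b} (\<lambda>t. A t \<bullet> (\<eta> t *\<^sub>R v) + B t \<bullet> (\<eta>' t *\<^sub>R v)) = 0"
    and t: "t \<in> {a..b}"
  shows "(B has_vector_derivative A t) (at t within {a..b})"
proof -
  define P where "P s = integral {a..s} A" for s
  have P: "(P has_vector_derivative A s) (at s within {a..b})" if "s \<in> {a..b}" for s
    unfolding P_def by (rule integral_has_vector_derivative[OF A that])
  have cP: "continuous_on {a..b} P"
    using P by (meson continuous_on_eq_continuous_within has_vector_derivative_continuous)
  have "\<exists>c. \<forall>t\<in>{a..b}. (B t - P t) \<bullet> v = c" for v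
  proof (rule du_Bois_Reymond_constant[OF \<open>a < b\<close>])
    show "continuous_on {a..b} (\<lambda>t. (B t - P t) \<bullet> v)"
      by (intro continuous_intros B cP)
    fix \<eta> \<eta>' :: "real \<Rightarrow> real" assume v: "variation_on a b \<eta> \<eta>'"
    have c: "continuous_on {a..b} \<eta>" "continuous_on {a..b} \<eta>'"
      using variation_continuous[OF v] by auto
    have "((\<lambda>t. A t \<bullet> (\<eta> t *\<^sub>R v) + P t \<bullet> (\<eta>' t *\<^sub>R v)) has_integral
        (P b \<bullet> (\<eta> b *\<^sub>R v) - P a \<bullet> (\<eta> a *\<^sub>R v))) {a..b}"
    proof (rule fundamental_theorem_of_calculus)
      fix x assume x: "x \<in> {a..b}"
      have \<eta>: "(\<eta> has_vector_derivative \<eta>' x) (at x within {a..b})"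
        using v by (auto simp: variation_on_def intro: has_vector_derivative_at_within)
      show "((\<lambda>t. P t \<bullet> (\<eta> t *\<^sub>R v)) has_vector_derivative
          A x \<bullet> (\<eta> x *\<^sub>R v) + P x \<bullet> (\<eta>' x *\<^sub>R v)) (at x within {a..b})"
        using P[OF x] \<eta> unfolding has_vector_derivative_def
        by (auto intro!: derivative_eq_intros simp: algebra_simps)
    qed (use \<open>a < b\<close> in auto)
    moreover have "\<eta> a = 0" "\<eta> b = 0" using v by (auto simp: variation_on_def)
    ultimately have "integral {a..b} (\<lambda>t. A t \<bullet> (\<eta> t *\<^sub>R v) + P t \<bullet> (\<eta>' t *\<^sub>R v)) = 0"
      by (simp add: integral_unique)
    then have "integral {a..b} (\<lambda>t. (A t \<bullet> (\<eta> t *\<^sub>R v) + B t \<bullet> (\<eta>' t *\<^sub>R v)) -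
        (A t \<bullet> (\<eta> t *\<^sub>R v) + P t \<bullet> (\<eta>' t *\<^sub>R v))) = 0"
      using zero[OF v, of v]
      by (subst integral_diff)
         (auto intro!: integrable_continuous_real continuous_intros A B cP c)
    then show "integral {a..b} (\<lambda>t. \<eta>' t * ((B t - P t) \<bullet> v)) = 0"
      by (simp add: algebra_simps)
  qed
  then have "(B s - P s) \<bullet> v = (B t - P t) \<bullet> v" if "s \<in> {a..b}" for s v
    using t that by metis
  then have eq: "B s = P s + (B t - P t)" if "s \<in> {a..b}" for s
    using that by (metis diff_add_cancel vector_eq_rdot add.commute)
  have "((\<lambda>s. P s + (B t - P t)) has_vector_derivative A t) (at t within {a..b})"
    by (rule derivative_eq_intros P[OF t] | simp)+
  then show ?thesis
    by (rule has_vector_derivative_transform[OF t, rotated]) (rule eq)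
qed

section \<open>Partial gradients of continuously differentiable integrands\<close>

text \<open>Existence is the Riesz representation in an orthonormal basis; together with uniqueness of
  derivatives it makes the definite description in the definition of the gradient meaningful.\<close>
lemma gradient_inner:
  fixes f :: "'a::euclidean_space \<Rightarrow> real"
  assumes "(f has_derivative f') (at x)"
  shows "gradient f x \<bullet> u = f' u"
proof -
  let ?D = "\<Sum>b\<in>Basis. f' b *\<^sub>R b"
  interpret f': bounded_linear f' using assms by (rule has_derivative_bounded_linear)
  have f': "f' = (\<lambda>h. h \<bullet> ?D)"
  proof
    fix h
    have "f' h = f' (\<Sum>b\<in>Basis. (h \<bullet> b) *\<^sub>R b)" by (simp add: euclidean_representation)
    also have "\<dots> = h \<bullet> ?D"
      by (simp add: f'.sum f'.scaleR inner_sum_right mult.commute)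
    finally show "f' h = h \<bullet> ?D" .
  qed
  have "gradient f x = ?D"
    unfolding gradient_def
  proof (rule the_equality)
    show "GDERIV f x :> ?D" using assms f' by (simp add: gderiv_def)
    fix D assume "GDERIV f x :> D"
    then have "(\<lambda>h. h \<bullet> D) = f'"
      using has_derivative_unique assms unfolding gderiv_def by blast
    then show "D = ?D" using f' by (metis vector_eq_ldot)
  qed
  then show ?thesis using f' by (metis inner_commute)
qed

text \<open>All four gradients are in vector directions, along which the set \<open>T \<times> UNIV\<close> has no boundary. So
  they come from two-sided derivatives, even at those times of \<open>T\<close> where the full derivative is only taken
  within the set.\<close>
lemma partial_derivatives:
  fixes G :: "'n::finite args \<Rightarrow> real"
  assumes G: "(G has_derivative G') (at x within T \<times> UNIV)" and x: "x \<in> T \<times> UNIV"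
  shows "G' (0, u2, u3, u4, u5) =
    partial2 G x \<bullet> u2 + partial3 G x \<bullet> u3 + partial4 G x \<bullet> u4 + partial5 G x \<bullet> u5"
proof -
  obtain t x2 x3 x4 x5 where xs: "x = (t, x2, x3, x4, x5)" by (metis surj_pair)
  have t: "t \<in> T" using x xs by auto
  interpret G': bounded_linear G' using G by (rule has_derivative_bounded_linear)
  have chain: "((\<lambda>z. G (c z)) has_derivative (\<lambda>u. G' (c' u))) (at z0)"
    if "(c has_derivative c') (at z0)" "c z0 = x" "\<And>z. c z \<in> T \<times> UNIV"
    for c :: "real ^ 'n \<Rightarrow> 'n args" and c' z0
    using that has_derivative_in_compose[of c c' z0 UNIV G G'] has_derivative_subset[OF G, of "range c"]
    by (simp add: image_subset_iff)
  have "partial2 G x \<bullet> u2 = G' (0, u2, 0, 0, 0)"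
    unfolding xs partial2.simps
    by (rule gradient_inner, rule chain)
       (auto simp: xs t zero_prod_def intro!: derivative_eq_intros)
  moreover have "partial3 G x \<bullet> u3 = G' (0, 0, u3, 0, 0)"
    unfolding xs partial3.simps
    by (rule gradient_inner, rule chain)
       (auto simp: xs t zero_prod_def intro!: derivative_eq_intros)
  moreover have "partial4 G x \<bullet> u4 = G' (0, 0, 0, u4, 0)"
    unfolding xs partial4.simps
    by (rule gradient_inner, rule chain)
       (auto simp: xs t zero_prod_def intro!: derivative_eq_intros)
  moreover have "partial5 G x \<bullet> u5 = G' (0, 0, 0, 0, u5)"
    unfolding xs partial5.simps
    by (rule gradient_inner, rule chain)
       (auto simp: xs t zero_prod_def intro!: derivative_eq_intros)
  ultimately show ?thesis
    by (simp add: G'.add[symmetric])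
qed

lemma C1_on_partials_continuous:
  fixes G :: "'n::finite args \<Rightarrow> real"
  assumes "C1_on G (T \<times> UNIV)"
  shows "continuous_on (T \<times> UNIV) (partial2 G)" "continuous_on (T \<times> UNIV) (partial3 G)"
    "continuous_on (T \<times> UNIV) (partial4 G)" "continuous_on (T \<times> UNIV) (partial5 G)"
proof -
  obtain G' :: "'n args \<Rightarrow> 'n args \<Rightarrow>\<^sub>L real"
    where G: "\<And>x. x \<in> T \<times> UNIV \<Longrightarrow> (G has_derivative G' x) (at x within T \<times> UNIV)"
    and cont: "continuous_on (T \<times> UNIV) G'"
    using assms unfolding C1_on_def by blast
  note eq = partial_derivatives[OF G]
  have comp: "continuous_on (T \<times> UNIV) P"
    if "\<And>x. x \<in> T \<times> UNIV \<Longrightarrow> \<forall>u. P x \<bullet> u = G' x (c u)"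
    for P :: "'n args \<Rightarrow> real ^ 'n" and c
  proof (subst continuous_on_componentwise, intro ballI)
    fix b :: "real ^ 'n"
    have "continuous_on (T \<times> UNIV) (\<lambda>x. G' x (c b))"
      by (intro continuous_intros cont)
    then show "continuous_on (T \<times> UNIV) (\<lambda>x. P x \<bullet> b)"
      by (rule continuous_on_eq) (simp add: that)
  qed
  show "continuous_on (T \<times> UNIV) (partial2 G)"
    by (rule comp[where c = "\<lambda>u. (0, u, 0, 0, 0)"]) (simp add: eq)
  show "continuous_on (T \<times> UNIV) (partial3 G)"
    by (rule comp[where c = "\<lambda>u. (0, 0, u, 0, 0)"]) (simp add: eq)
  show "continuous_on (T \<times> UNIV) (partial4 G)"
    by (rule comp[where c = "\<lambda>u. (0, 0, 0, u, 0)"]) (simp add: eq)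
  show "continuous_on (T \<times> UNIV) (partial5 G)"
    by (rule comp[where c = "\<lambda>u. (0, 0, 0, 0, u)"]) (simp add: eq)
qed

lemma C1_on_diff_mult:
  assumes "C1_on L S" "C1_on g S"
  shows "C1_on (\<lambda>x. L x - c * g x) S"
proof -
  obtain L' g' where L: "\<And>x. x \<in> S \<Longrightarrow> (L has_derivative blinfun_apply (L' x)) (at x within S)"
      "continuous_on S L'"
    and g: "\<And>x. x \<in> S \<Longrightarrow> (g has_derivative blinfun_apply (g' x)) (at x within S)"
      "continuous_on S g'"
    using assms unfolding C1_on_def by metis
  show ?thesis
    unfolding C1_on_def
  proof (intro exI[of _ "\<lambda>x. L' x - c *\<^sub>R g' x"] conjI ballI)
    show "continuous_on S (\<lambda>x. L' x - c *\<^sub>R g' x)"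
      by (intro continuous_intros L g)
    fix x assume "x \<in> S"
    show "((\<lambda>x. L x - c * g x) has_derivative blinfun_apply (L' x - c *\<^sub>R g' x)) (at x within S)"
      by (rule has_derivative_eq_rhs[OF has_derivative_diff[OF L(1) has_derivative_mult_right[OF g(1)]]])
         (use \<open>x \<in> S\<close> in \<open>auto simp: fun_eq_iff blinfun.diff_left blinfun.scaleR_left\<close>)
  qed
qed

lemma partials_diff_mult:
  fixes L g :: "'n::finite args \<Rightarrow> real"
  assumes L: "C1_on L (T \<times> UNIV)" and g: "C1_on g (T \<times> UNIV)" and x: "x \<in> T \<times> UNIV"
  shows "partial2 (\<lambda>x. L x - c * g x) x = partial2 L x - c *\<^sub>R partial2 g x"
    "partial3 (\<lambda>x. L x - c * g x) x = partial3 L x - c *\<^sub>R partial3 g x"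
    "partial4 (\<lambda>x. L x - c * g x) x = partial4 L x - c *\<^sub>R partial4 g x"
    "partial5 (\<lambda>x. L x - c * g x) x = partial5 L x - c *\<^sub>R partial5 g x"
proof -
  obtain L' g' where L': "(L has_derivative L') (at x within T \<times> UNIV)"
    and g': "(g has_derivative g') (at x within T \<times> UNIV)"
    using L g x unfolding C1_on_def by metis
  have F': "((\<lambda>x. L x - c * g x) has_derivative (\<lambda>u. L' u - c * g' u)) (at x within T \<times> UNIV)"
    by (intro derivative_intros L' g' | simp)+
  note eqs = partial_derivatives[OF F' x,
      unfolded partial_derivatives[OF L' x] partial_derivatives[OF g' x]]
  note all = vector_eq_rdot[THEN iffD1, OF allI]
  show "partial2 (\<lambda>x. L x - c * g x) x = partial2 L x - c *\<^sub>R partial2 g x"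
    by (rule all) (simp add: eqs[of _ 0 0 0, simplified, symmetric] inner_diff_left)
  show "partial3 (\<lambda>x. L x - c * g x) x = partial3 L x - c *\<^sub>R partial3 g x"
    by (rule all) (simp add: eqs[of 0 _ 0 0, simplified, symmetric] inner_diff_left)
  show "partial4 (\<lambda>x. L x - c * g x) x = partial4 L x - c *\<^sub>R partial4 g x"
    by (rule all) (simp add: eqs[of 0 0 _ 0, simplified, symmetric] inner_diff_left)
  show "partial5 (\<lambda>x. L x - c * g x) x = partial5 L x - c *\<^sub>R partial5 g x"
    by (rule all) (simp add: eqs[of 0 0 0 _, simplified, symmetric] inner_diff_left)
qed

section \<open>The first variation of a delayed functional\<close>

locale delayed_interval =
  fixes t1 t2 \<tau> :: real
  assumes tau_pos: "0 < \<tau>" and tau_less: "\<tau> < t2 - t1"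
begin

lemma C2_on_vector_derivative:
  fixes q :: "real \<Rightarrow> 'a::euclidean_space"
  assumes "C2_on q {t1 - \<tau>..t2}"
  obtains q' q'' where
    "\<And>t. t \<in> {t1 - \<tau>..t2} \<Longrightarrow> (q has_vector_derivative q' t) (at t within {t1 - \<tau>..t2})"
    "\<And>t. t \<in> {t1 - \<tau>..t2} \<Longrightarrow> (q' has_vector_derivative q'' t) (at t within {t1 - \<tau>..t2})"
    "continuous_on {t1 - \<tau>..t2} q''"
    "\<And>t. t \<in> {t1 - \<tau>..t2} \<Longrightarrow> vector_derivative q (at t within {t1 - \<tau>..t2}) = q' t"
proof -
  from assms obtain q' q'' where *:
    "\<forall>t\<in>{t1 - \<tau>..t2}. (q has_vector_derivative q' t) (at t within {t1 - \<tau>..t2})"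
    "\<forall>t\<in>{t1 - \<tau>..t2}. (q' has_vector_derivative q'' t) (at t within {t1 - \<tau>..t2})"
    "continuous_on {t1 - \<tau>..t2} q''"
    unfolding C2_on_def by blast
  moreover have "vector_derivative q (at t within {t1 - \<tau>..t2}) = q' t"
    if "t \<in> {t1 - \<tau>..t2}" for t
    by (rule vector_derivative_within_closed_interval[OF _ that]) (use * that tau_pos tau_less in auto)
  ultimately show ?thesis using that[of q' q''] by blast
qed

lemma delayed_continuous:
  assumes "C2_on q {t1 - \<tau>..t2}"
  shows "continuous_on {t1..t2} (delayed t1 t2 \<tau> q)"
proof -
  obtain q' q'' where q:
    "\<And>t. t \<in> {t1 - \<tau>..t2} \<Longrightarrow> (q has_vector_derivative q' t) (at t within {t1 - \<tau>..t2})"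
    "\<And>t. t \<in> {t1 - \<tau>..t2} \<Longrightarrow> (q' has_vector_derivative q'' t) (at t within {t1 - \<tau>..t2})"
    "\<And>t. t \<in> {t1 - \<tau>..t2} \<Longrightarrow> vector_derivative q (at t within {t1 - \<tau>..t2}) = q' t"
    using C2_on_vector_derivative[OF assms] by metis
  have c: "continuous_on {t1 - \<tau>..t2} q" "continuous_on {t1 - \<tau>..t2} q'"
    using q(1,2) by (meson continuous_on_eq_continuous_within has_vector_derivative_continuous)+
  have "continuous_on {t1..t2} (\<lambda>t. (t, q t, q' t, q (t - \<tau>), q' (t - \<tau>)))"
    using tau_pos
    by (intro continuous_intros continuous_on_compose2[OF c(1)] continuous_on_compose2[OF c(2)]) auto
  then show ?thesis
    by (rule continuous_on_eq) (use tau_pos q(3) in \<open>auto simp: delayed_def Let_def\<close>)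
qed

lemma delayed_in: "t \<in> {t1..t2} \<Longrightarrow> delayed t1 t2 \<tau> q t \<in> {t1..t2} \<times> UNIV"
  by (simp add: delayed_def)

text \<open>The derivative of the delayed argument list of \<open>q + a h\<close> with respect to \<open>a\<close>; time itself is not
  varied.\<close>
definition delayed_direction ::
  "(real \<Rightarrow> real ^ 'n) \<Rightarrow> (real \<Rightarrow> real ^ 'n) \<Rightarrow> real \<Rightarrow> 'n::finite args" where
  "delayed_direction h h' t = (0, h t, h' t, h (t - \<tau>), h' (t - \<tau>))"

lemma delayed_direction_continuous:
  assumes "variation_on t1 t2 h h'"
  shows "continuous_on S (delayed_direction h h')"
  unfolding delayed_direction_def
  by (intro continuous_intros continuous_on_compose2[OF variation_continuous(1)[OF assms, of UNIV]]
      continuous_on_compose2[OF variation_continuous(2)[OF assms, of UNIV]]) auto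

lemma perturbation_derivative:
  fixes h k q q' :: "real \<Rightarrow> 'a::real_normed_vector"
  assumes "(q has_vector_derivative q' t) (at t within S)"
    "(h has_vector_derivative h') (at t)" "(k has_vector_derivative k') (at t)"
  shows "((\<lambda>s. q s + (a *\<^sub>R h s + b *\<^sub>R k s)) has_vector_derivative
    q' t + (a *\<^sub>R h' + b *\<^sub>R k')) (at t within S)"
  using assms(1) assms(2,3)[THEN has_vector_derivative_at_within, of S]
  unfolding has_vector_derivative_def
  by (auto intro!: derivative_eq_intros simp: algebra_simps)

lemma perturbation:
  fixes q h k :: "real \<Rightarrow> real ^ 'n::finite"
  assumes q: "C2_on q {t1 - \<tau>..t2}" and h: "variation_on t1 t2 h h'" and k: "variation_on t1 t2 k k'"
  shows perturbation_C2: "C2_on (\<lambda>s. q s + (a *\<^sub>R h s + b *\<^sub>R k s)) {t1 - \<tau>..t2}"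
    and perturbation_delayed: "t \<in> {t1..t2} \<Longrightarrow>
      delayed t1 t2 \<tau> (\<lambda>s. q s + (a *\<^sub>R h s + b *\<^sub>R k s)) t =
      delayed t1 t2 \<tau> q t +
        (a *\<^sub>R delayed_direction h h' t + b *\<^sub>R delayed_direction k k' t)"
proof -
  let ?I = "{t1 - \<tau>..t2}"
  let ?p = "\<lambda>s. q s + (a *\<^sub>R h s + b *\<^sub>R k s)"
  obtain q' q'' where q':
    "\<And>t. t \<in> ?I \<Longrightarrow> (q has_vector_derivative q' t) (at t within ?I)"
    "\<And>t. t \<in> ?I \<Longrightarrow> (q' has_vector_derivative q'' t) (at t within ?I)"
    "continuous_on ?I q''"
    "\<And>t. t \<in> ?I \<Longrightarrow> vector_derivative q (at t within ?I) = q' t"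
    using C2_on_vector_derivative[OF q] by metis
  obtain h'' where h': "\<And>t. (h has_vector_derivative h' t) (at t)"
    "\<And>t. (h' has_vector_derivative h'' t) (at t)" "continuous_on UNIV h''"
    using h unfolding variation_on_def by blast
  obtain k'' where k': "\<And>t. (k has_vector_derivative k' t) (at t)"
    "\<And>t. (k' has_vector_derivative k'' t) (at t)" "continuous_on UNIV k''"
    using k unfolding variation_on_def by blast
  have p': "(?p has_vector_derivative q' s + (a *\<^sub>R h' s + b *\<^sub>R k' s)) (at s within ?I)"
    if "s \<in> ?I" for s
    using perturbation_derivative[of q q', OF q'(1)[OF that] h'(1) k'(1)] .
  show "C2_on ?p ?I"
    unfolding C2_on_def
  proof (intro exI conjI ballI)
    show "continuous_on ?I (\<lambda>s. q'' s + (a *\<^sub>R h'' s + b *\<^sub>R k'' s))"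
      by (intro continuous_intros q'(3) continuous_on_subset[OF h'(3)] continuous_on_subset[OF k'(3)])
         auto
  qed (rule p' perturbation_derivative[OF q'(2) h'(2) k'(2)], assumption)+
  have vd: "vector_derivative ?p (at s within ?I) = q' s + (a *\<^sub>R h' s + b *\<^sub>R k' s)"
    if "s \<in> ?I" for s
    by (rule vector_derivative_within_closed_interval[OF _ that p'[OF that]])
       (use tau_pos tau_less in auto)
  show "delayed t1 t2 \<tau> ?p t = delayed t1 t2 \<tau> q t +
        (a *\<^sub>R delayed_direction h h' t + b *\<^sub>R delayed_direction k k' t)" if "t \<in> {t1..t2}"
    using that tau_pos
    by (simp add: delayed_def delayed_direction_def Let_def vd q'(4))
qed

text \<open>The derivative of the functional of \<open>G\<close> at \<open>q\<close> in the direction \<open>h\<close>, where \<open>h'\<close> stands for the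
  derivative of \<open>h\<close>.\<close>
definition first_variation ::
  "('n::finite args \<Rightarrow> real) \<Rightarrow> (real \<Rightarrow> real ^ 'n) \<Rightarrow>
    (real \<Rightarrow> real ^ 'n) \<Rightarrow> (real \<Rightarrow> real ^ 'n) \<Rightarrow> real" where
  "first_variation G q h h' = integral {t1..t2} (\<lambda>t.
     partial2 G (delayed t1 t2 \<tau> q t) \<bullet> h t + partial3 G (delayed t1 t2 \<tau> q t) \<bullet> h' t +
     partial4 G (delayed t1 t2 \<tau> q t) \<bullet> h (t - \<tau>) + partial5 G (delayed t1 t2 \<tau> q t) \<bullet> h' (t - \<tau>))"

text \<open>Differentiation under the integral sign. For each time \<open>t\<close> the argument of \<open>G\<close> is an affine function of
  \<open>(a, b)\<close> that never leaves \<open>[t1, t2] \<times> UNIV\<close>, so derivatives of \<open>G\<close> within that set suffice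
  and \<open>(a, b)\<close> can range over the whole plane.\<close>
lemma delayed_integral_perturbation:
  fixes q h k :: "real \<Rightarrow> real ^ 'n::finite"
  assumes G: "C1_on G ({t1..t2} \<times> UNIV)" and q: "C2_on q {t1 - \<tau>..t2}"
    and h: "variation_on t1 t2 h h'" and k: "variation_on t1 t2 k k'"
  defines "J \<equiv> (\<lambda>(a, b). delayed_integral t1 t2 \<tau> G (\<lambda>s. q s + (a *\<^sub>R h s + b *\<^sub>R k s)))"
  shows "continuous_on UNIV J"
    and "(J has_derivative (\<lambda>(a, b). a * first_variation G q h h' + b * first_variation G q k k'))
      (at (0, 0))"
proof -
  obtain G' :: "'n args \<Rightarrow> 'n args \<Rightarrow>\<^sub>L real"
    where G': "\<And>x. x \<in> {t1..t2} \<times> UNIV \<Longrightarrow>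
        (G has_derivative G' x) (at x within {t1..t2} \<times> UNIV)"
    and cG': "continuous_on ({t1..t2} \<times> UNIV) G'"
    using G unfolding C1_on_def by blast
  have cG: "continuous_on ({t1..t2} \<times> UNIV) G"
    using G' has_derivative_continuous continuous_on_eq_continuous_within by blast
  define d where "d = delayed t1 t2 \<tau> q"
  define H where "H = delayed_direction h h'"
  define K where "K = delayed_direction k k'"
  have cd: "continuous_on {t1..t2} d" unfolding d_def by (rule delayed_continuous[OF q])
  have cH: "continuous_on {t1..t2} H" and cK: "continuous_on {t1..t2} K"
    unfolding H_def K_def by (rule delayed_direction_continuous, fact)+
  define y where "y z t = d t + (fst z *\<^sub>R H t + snd z *\<^sub>R K t)" for z :: "real \<times> real" and t
  have y_in: "y z t \<in> {t1..t2} \<times> UNIV" if "t \<in> {t1..t2}" for z t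
    using that by (simp add: y_def d_def delayed_def H_def K_def delayed_direction_def)
  have cy: "continuous_on {t1..t2} (y z)" for z
    unfolding y_def by (intro continuous_intros cd cH cK)
  have J: "J z = integral (cbox t1 t2) (\<lambda>t. G (y z t))" for z
    unfolding J_def delayed_integral_def case_prod_beta cbox_interval
    by (rule integral_cong)
       (simp add: perturbation_delayed[OF q h k] y_def d_def H_def K_def)
  define D where "D z t = G' (y z t) (H t) *\<^sub>R (fst_blinfun :: (real \<times> real) \<Rightarrow>\<^sub>L real) +
      G' (y z t) (K t) *\<^sub>R snd_blinfun" for z t
  have c1: "continuous_on (UNIV \<times> {t1..t2}) (\<lambda>x. f (snd x))" if "continuous_on {t1..t2} f"
    for f :: "real \<Rightarrow> 'n args"
    by (rule continuous_on_compose2[OF that]) (auto intro: continuous_intros)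
  have cy2: "continuous_on (UNIV \<times> {t1..t2}) (\<lambda>x. y (fst x) (snd x))"
    unfolding y_def by (intro continuous_intros c1 cd cH cK)
  have cG'2: "continuous_on (UNIV \<times> {t1..t2}) (\<lambda>x. G' (y (fst x) (snd x)))"
    by (rule continuous_on_compose2[OF cG' cy2]) (rule image_subsetI, rule y_in, auto)
  have deriv: "(J has_derivative integral (cbox t1 t2) (D z)) (at z)" for z
    unfolding J[abs_def]
  proof (rule leibniz_rule[where U = UNIV])
    fix z t assume "t \<in> cbox t1 t2"
    then have t: "t \<in> {t1..t2}" by simp
    have "((\<lambda>z. y z t) has_derivative (\<lambda>w. fst w *\<^sub>R H t + snd w *\<^sub>R K t)) (at z)"
      unfolding y_def by (auto intro!: derivative_eq_intros)
    from has_derivative_in_compose[OF this has_derivative_subset[OF G'[OF y_in[OF t, of z]]]]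
    have "((\<lambda>z. G (y z t)) has_derivative
        (\<lambda>w. G' (y z t) (fst w *\<^sub>R H t + snd w *\<^sub>R K t))) (at z)"
      using y_in[OF t] by blast
    then show "((\<lambda>z. G (y z t)) has_derivative blinfun_apply (D z t)) (at z)"
      by (simp add: D_def blinfun.add_left blinfun.scaleR_left blinfun.add_right
          blinfun.scaleR_right mult.commute plus_blinfun.rep_eq)
  next
    fix z
    have "continuous_on {t1..t2} (\<lambda>t. G (y z t))"
      by (rule continuous_on_compose2[OF cG cy]) (rule image_subsetI, rule y_in, auto)
    then show "(\<lambda>t. G (y z t)) integrable_on cbox t1 t2"
      by (simp add: integrable_continuous_real)
  next
    show "continuous_on (UNIV \<times> cbox t1 t2) (\<lambda>(z, t). D z t)"
      unfolding D_def case_prod_beta cbox_interval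
      by (intro continuous_intros cG'2 c1 cH cK)
  qed auto
  show "continuous_on UNIV J"
    using deriv has_derivative_continuous by (blast intro: continuous_at_imp_continuous_on)
  have fv: "((\<lambda>t. G' (y (0, 0) t) (delayed_direction f f' t)) has_integral first_variation G q f f')
      {t1..t2}" if f: "variation_on t1 t2 f f'" for f f'
  proof -
    have "continuous_on {t1..t2} (\<lambda>t. G' (y (0, 0) t))"
      by (rule continuous_on_compose2[OF cG' cy]) (rule image_subsetI, rule y_in, auto)
    then have i: "(\<lambda>t. G' (y (0, 0) t) (delayed_direction f f' t)) integrable_on {t1..t2}"
      by (intro integrable_continuous_real continuous_intros delayed_direction_continuous[OF f])
    have e: "integral {t1..t2} (\<lambda>t. G' (y (0, 0) t) (delayed_direction f f' t)) =
        first_variation G q f f'"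
      unfolding first_variation_def
    proof (rule integral_cong)
      fix t assume t: "t \<in> {t1..t2}"
      then show "G' (y (0, 0) t) (delayed_direction f f' t) =
        partial2 G (delayed t1 t2 \<tau> q t) \<bullet> f t + partial3 G (delayed t1 t2 \<tau> q t) \<bullet> f' t +
        partial4 G (delayed t1 t2 \<tau> q t) \<bullet> f (t - \<tau>) +
        partial5 G (delayed t1 t2 \<tau> q t) \<bullet> f' (t - \<tau>)"
        unfolding delayed_direction_def
        by (subst partial_derivatives[OF G' y_in])
           (use delayed_in[OF t, of q] in \<open>simp_all add: y_def d_def\<close>)
    qed
    show ?thesis using integrable_integral[OF i] unfolding e .
  qed
  have "(D (0, 0) has_integral
      first_variation G q h h' *\<^sub>R fst_blinfun + first_variation G q k k' *\<^sub>R snd_blinfun) {t1..t2}"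
    unfolding D_def H_def K_def
    by (intro has_integral_add has_integral_scaleR_left fv h k)
  then have "integral (cbox t1 t2) (D (0, 0)) =
      first_variation G q h h' *\<^sub>R fst_blinfun + first_variation G q k k' *\<^sub>R snd_blinfun"
    by (simp add: integral_unique)
  then have "blinfun_apply (integral (cbox t1 t2) (D (0, 0))) =
      (\<lambda>(a, b). a * first_variation G q h h' + b * first_variation G q k k')"
    by (auto simp: fun_eq_iff blinfun.add_left blinfun.scaleR_left)
  then show "(J has_derivative (\<lambda>(a, b). a * first_variation G q h h' + b * first_variation G q k k'))
      (at (0, 0))"
    using deriv[of "(0, 0)"] by simp
qed

lemma partials_delayed_continuous:
  assumes "C1_on G ({t1..t2} \<times> UNIV)" and "C2_on q {t1 - \<tau>..t2}"
  shows "continuous_on {t1..t2} (\<lambda>t. partial2 G (delayed t1 t2 \<tau> q t))"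
    "continuous_on {t1..t2} (\<lambda>t. partial3 G (delayed t1 t2 \<tau> q t))"
    "continuous_on {t1..t2} (\<lambda>t. partial4 G (delayed t1 t2 \<tau> q t))"
    "continuous_on {t1..t2} (\<lambda>t. partial5 G (delayed t1 t2 \<tau> q t))"
  by (rule C1_on_partials_continuous[OF assms(1), THEN continuous_on_compose2,
        OF delayed_continuous[OF assms(2)]]; use delayed_in in blast)+

lemma first_variation_diff_mult:
  fixes q :: "real \<Rightarrow> real ^ 'n::finite"
  assumes L: "C1_on L ({t1..t2} \<times> UNIV)" and g: "C1_on g ({t1..t2} \<times> UNIV)"
    and q: "C2_on q {t1 - \<tau>..t2}" and h: "variation_on t1 t2 h h'"
  shows "first_variation (\<lambda>x. L x - c * g x) q h h' =
    first_variation L q h h' - c * first_variation g q h h'"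
proof -
  let ?i = "\<lambda>G t. partial2 G (delayed t1 t2 \<tau> q t) \<bullet> h t + partial3 G (delayed t1 t2 \<tau> q t) \<bullet> h' t +
     partial4 G (delayed t1 t2 \<tau> q t) \<bullet> h (t - \<tau>) + partial5 G (delayed t1 t2 \<tau> q t) \<bullet> h' (t - \<tau>)"
  have int: "(?i G has_integral first_variation G q h h') {t1..t2}"
    if G: "C1_on G ({t1..t2} \<times> UNIV)" for G
  proof -
    have "continuous_on {t1..t2} (?i G)"
      by (intro continuous_intros partials_delayed_continuous[OF G q] variation_continuous[OF h]
          continuous_on_compose2[OF variation_continuous(1)[OF h, of UNIV]]
          continuous_on_compose2[OF variation_continuous(2)[OF h, of UNIV]]) auto
    then show ?thesis
      unfolding first_variation_def by (intro integrable_integral integrable_continuous_real)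
  qed
  have "((\<lambda>t. ?i L t - c * ?i g t) has_integral
      (first_variation L q h h' - c * first_variation g q h h')) {t1..t2}"
    by (intro has_integral_diff has_integral_mult_right int L g)
  then have "(?i (\<lambda>x. L x - c * g x) has_integral
      (first_variation L q h h' - c * first_variation g q h h')) {t1..t2}"
    by (rule has_integral_eq[rotated])
       (simp add: partials_diff_mult[OF L g delayed_in] inner_diff_left algebra_simps)
  then show ?thesis
    unfolding first_variation_def[of "\<lambda>x. L x - c * g x"] by (rule integral_unique)
qed

section \<open>The multiplier rule\<close>

text \<open>Small parameters give competitors close to \<open>q\<close> in the \<open>C\<^sup>1\<close> norm, because the variations and their
  derivatives are bounded on the compact time interval.\<close>
lemma perturbation_C1_norm:
  fixes q h k :: "real \<Rightarrow> 'a::euclidean_space"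
  assumes h: "variation_on t1 t2 h h'" and k: "variation_on t1 t2 k k'" and "\<epsilon> > 0"
  shows "\<exists>r>0. \<forall>a b. norm (a, b) < r \<longrightarrow>
    C1_norm_on {t1 - \<tau>..t2} (\<lambda>s. (q s + (a *\<^sub>R h s + b *\<^sub>R k s)) - q s) < \<epsilon>"
proof -
  let ?I = "{t1 - \<tau>..t2}"
  have "\<exists>M. \<forall>t\<in>?I. norm (f t) \<le> M" if "continuous_on ?I f" for f :: "real \<Rightarrow> 'a"
    using compact_imp_bounded[OF compact_continuous_image[OF that compact_Icc]]
    by (auto simp: bounded_iff)
  then obtain M1 M2 M3 M4 where "\<forall>t\<in>?I. norm (h t) \<le> M1" "\<forall>t\<in>?I. norm (h' t) \<le> M2"
    "\<forall>t\<in>?I. norm (k t) \<le> M3" "\<forall>t\<in>?I. norm (k' t) \<le> M4"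
    using variation_continuous[OF h] variation_continuous[OF k] by metis
  moreover define M where "M = Max {1, M1, M2, M3, M4}"
  ultimately have M: "norm (h t) \<le> M" "norm (h' t) \<le> M" "norm (k t) \<le> M" "norm (k' t) \<le> M"
    if "t \<in> ?I" for t
    using that by (auto simp: le_max_iff_disj)
  have "M \<ge> 1" by (simp add: M_def)
  have ne: "?I \<noteq> {}" using tau_pos tau_less by auto
  have "C1_norm_on ?I (\<lambda>s. (q s + (a *\<^sub>R h s + b *\<^sub>R k s)) - q s) < \<epsilon>"
    if r: "norm (a, b) < \<epsilon> / (4 * M)" for a b :: real
  proof -
    have le: "norm (a *\<^sub>R u + b *\<^sub>R v) \<le> 2 * M * norm (a, b)" if "norm u \<le> M" "norm v \<le> M" for u v :: 'a
    proof -
      have ab: "\<bar>a\<bar> \<le> norm (a, b)" "\<bar>b\<bar> \<le> norm (a, b)"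
        using norm_fst_le[of a b] norm_snd_le[of b a] by auto
      have "norm (a *\<^sub>R u + b *\<^sub>R v) \<le> \<bar>a\<bar> * norm u + \<bar>b\<bar> * norm v"
        by (metis norm_triangle_ineq norm_scaleR)
      also have "\<dots> \<le> norm (a, b) * M + norm (a, b) * M"
        using ab that by (intro add_mono mult_mono) auto
      finally show ?thesis by (simp add: algebra_simps)
    qed
    let ?f = "\<lambda>s. a *\<^sub>R h s + b *\<^sub>R k s"
    have vd: "vector_derivative ?f (at t within ?I) = a *\<^sub>R h' t + b *\<^sub>R k' t" if "t \<in> ?I" for t
    proof (rule vector_derivative_within_closed_interval[OF _ that])
      have "((\<lambda>s. 0 + ?f s) has_vector_derivative 0 + (a *\<^sub>R h' t + b *\<^sub>R k' t)) (at t within ?I)"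
        by (rule perturbation_derivative[where q' = "\<lambda>_. 0"])
           (use h k in \<open>auto simp: variation_on_def\<close>)
      then show "(?f has_vector_derivative a *\<^sub>R h' t + b *\<^sub>R k' t) (at t within ?I)"
        by simp
    qed (use tau_pos tau_less in auto)
    have "C1_norm_on ?I ?f \<le> 2 * M * norm (a, b) + 2 * M * norm (a, b)"
      unfolding C1_norm_on_def
      by (intro add_mono cSUP_least ne) (auto simp: vd intro!: le M)
    also have "\<dots> < \<epsilon>"
      using r \<open>M \<ge> 1\<close> by (simp add: field_simps)
    finally show ?thesis by simp
  qed
  moreover have "\<epsilon> / (4 * M) > 0" using \<open>\<epsilon> > 0\<close> \<open>M \<ge> 1\<close> by simp
  ultimately show ?thesis by blast
qed

text \<open>The vanishing of a two-by-two determinant. Otherwise the open mapping lemma, applied to the pair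
  of functionals, yields admissible functions arbitrarily close to \<open>q\<close> whose cost is smaller, and
  others whose cost is larger, than that of \<open>q\<close>.\<close>
lemma first_variations_proportional:
  fixes q h k :: "real \<Rightarrow> real ^ 'n::finite"
  assumes L: "C1_on L ({t1..t2} \<times> UNIV)" and g: "C1_on g ({t1..t2} \<times> UNIV)"
    and ext: "extremizer t1 t2 \<tau> \<delta> qt2 L g l q"
    and h: "variation_on t1 t2 h h'" and k: "variation_on t1 t2 k k'"
  shows "first_variation L q h h' * first_variation g q k k' =
    first_variation L q k k' * first_variation g q h h'"
proof (rule ccontr)
  assume ne: "\<not> ?thesis"
  let ?p = "\<lambda>z s. q s + (fst z *\<^sub>R h s + snd z *\<^sub>R k s)"
  have adm: "admissible t1 t2 \<tau> \<delta> qt2 g l q"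
    using ext by (auto simp: extremizer_def local_minimizer_def local_maximizer_def)
  then have q: "C2_on q {t1 - \<tau>..t2}" by (simp add: admissible_def)
  define Jof where "Jof G z = delayed_integral t1 t2 \<tau> G (?p z)" for G and z :: "real \<times> real"
  have Jof: "continuous_on UNIV (Jof G)"
    "(Jof G has_derivative (\<lambda>z. fst z * first_variation G q h h' + snd z * first_variation G q k k'))
      (at (0, 0))"
    if "C1_on G ({t1..t2} \<times> UNIV)" for G
    using delayed_integral_perturbation[OF that q h k]
    unfolding Jof_def[abs_def] case_prod_unfold by simp_all
  have Jof0: "Jof G (0, 0) = delayed_integral t1 t2 \<tau> G q" for G by (simp add: Jof_def)
  have p_adm: "admissible t1 t2 \<tau> \<delta> qt2 g l (?p z)" if "Jof g z = l" for z
  proof -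
    have "h t = 0 \<and> k t = 0" if "t \<le> t1 \<or> t = t2" for t
      using h k that by (auto simp: variation_on_def)
    then show ?thesis
      using adm that perturbation_C2[OF q h k] by (auto simp: admissible_def Jof_def)
  qed
  define a where "a = first_variation L q h h'"
  define b where "b = first_variation L q k k'"
  define c where "c = first_variation g q h h'"
  define d where "d = first_variation g q k k'"
  have det: "a * d - b * c \<noteq> 0" using ne by (simp add: a_def b_def c_def d_def)
  have hit: "\<exists>e>0. \<forall>x. \<bar>x - Jof L (0, 0)\<bar> < e \<longrightarrow>
      (\<exists>z. norm z < r \<and> Jof L z = x \<and> Jof g z = l)" if "r > 0" for r
  proof -
    have "(Jof L (0, 0), Jof g (0, 0)) \<in> interior ((\<lambda>z. (Jof L z, Jof g z)) ` ball (0, 0) r)"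
    proof (rule sussmann_open_mapping[where S = UNIV])
      show "continuous_on UNIV (\<lambda>z. (Jof L z, Jof g z))"
        by (intro continuous_intros Jof L g)
      show "((\<lambda>z. (Jof L z, Jof g z)) has_derivative
          (\<lambda>z. (fst z * a + snd z * b, fst z * c + snd z * d))) (at (0, 0))"
        unfolding a_def b_def c_def d_def by (intro has_derivative_Pair Jof L g)
      \<comment> \<open>Cramer's rule gives the inverse of the derivative.\<close>
      show "bounded_linear (\<lambda>w. ((fst w * d - snd w * b) / (a * d - b * c),
          (snd w * a - fst w * c) / (a * d - b * c)))"
        by (intro bounded_linear_Pair bounded_linear_sub
            bounded_linear_compose[OF bounded_linear_divide]
            bounded_linear_compose[OF bounded_linear_mult_left] bounded_linear_fst bounded_linear_snd)
      show "(\<lambda>z. (fst z * a + snd z * b, fst z * c + snd z * d)) \<circ>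
          (\<lambda>w. ((fst w * d - snd w * b) / (a * d - b * c),
            (snd w * a - fst w * c) / (a * d - b * c))) = id"
        using det by (auto simp: fun_eq_iff add_divide_distrib[symmetric] divide_eq_eq algebra_simps)
    qed (use that in auto)
    then obtain e where e: "e > 0"
      "ball (Jof L (0, 0), Jof g (0, 0)) e \<subseteq> (\<lambda>z. (Jof L z, Jof g z)) ` ball (0, 0) r"
      unfolding mem_interior by blast
    have l: "Jof g (0, 0) = l" using adm by (simp add: admissible_def Jof0)
    have "\<exists>z. norm z < r \<and> Jof L z = x \<and> Jof g z = l" if "\<bar>x - Jof L (0, 0)\<bar> < e" for x
    proof -
      have "(x, l) \<in> ball (Jof L (0, 0), Jof g (0, 0)) e"
        using that l by (simp add: dist_Pair_Pair dist_real_def abs_minus_commute)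
      then have "(x, l) \<in> (\<lambda>z. (Jof L z, Jof g z)) ` ball (0, 0) r"
        using e(2) by blast
      then obtain z where "z \<in> ball (0, 0) r" "Jof L z = x" "Jof g z = l"
        by blast
      then show ?thesis by (intro exI[of _ z]) (simp add: dist_norm zero_prod_def[symmetric])
    qed
    then show ?thesis using e(1) by blast
  qed
  have near: "\<exists>p. admissible t1 t2 \<tau> \<delta> qt2 g l p \<and>
      C1_norm_on {t1 - \<tau>..t2} (\<lambda>t. p t - q t) < \<epsilon> \<and>
      sgn (delayed_integral t1 t2 \<tau> L p - delayed_integral t1 t2 \<tau> L q) = \<sigma>"
    if eps: "\<epsilon> > 0" and \<sigma>: "\<sigma> \<in> {-1, 1}" for \<epsilon> \<sigma> :: real
  proof -
    obtain r where "r > 0" and r: "\<And>a b. norm (a, b) < r \<Longrightarrow>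
        C1_norm_on {t1 - \<tau>..t2} (\<lambda>s. (q s + (a *\<^sub>R h s + b *\<^sub>R k s)) - q s) < \<epsilon>"
      using perturbation_C1_norm[OF h k eps, of q] by blast
    obtain e where "e > 0" and e: "\<And>x. \<bar>x - Jof L (0, 0)\<bar> < e \<Longrightarrow>
        \<exists>z. norm z < r \<and> Jof L z = x \<and> Jof g z = l"
      using hit[OF \<open>r > 0\<close>] by blast
    have "\<bar>(Jof L (0, 0) + \<sigma> * (e / 2)) - Jof L (0, 0)\<bar> < e"
      using \<open>e > 0\<close> \<sigma> by auto
    from e[OF this] obtain z where
      z: "norm z < r" "Jof L z = Jof L (0, 0) + \<sigma> * (e / 2)" "Jof g z = l"
      by blast
    have "C1_norm_on {t1 - \<tau>..t2} (\<lambda>t. ?p z t - q t) < \<epsilon>"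
      using r[of "fst z" "snd z"] z(1) by simp
    moreover have "sgn (delayed_integral t1 t2 \<tau> L (?p z) - delayed_integral t1 t2 \<tau> L q) = \<sigma>"
      using z(2) \<open>e > 0\<close> \<sigma> unfolding Jof0 Jof_def[of L z] by (auto simp: sgn_mult)
    ultimately show ?thesis using p_adm[OF z(3)] by blast
  qed
  from ext show False
    unfolding extremizer_def
  proof
    assume "local_minimizer t1 t2 \<tau> \<delta> qt2 L g l q"
    then obtain \<epsilon> where "\<epsilon> > 0" and min: "\<And>p. admissible t1 t2 \<tau> \<delta> qt2 g l p \<Longrightarrow>
        C1_norm_on {t1 - \<tau>..t2} (\<lambda>t. p t - q t) < \<epsilon> \<Longrightarrow>
        delayed_integral t1 t2 \<tau> L q \<le> delayed_integral t1 t2 \<tau> L p"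
      unfolding local_minimizer_def by blast
    with near[OF \<open>\<epsilon> > 0\<close>, of "- 1"] show False
      by (auto simp: sgn_if split: if_splits dest: min)
  next
    assume "local_maximizer t1 t2 \<tau> \<delta> qt2 L g l q"
    then obtain \<epsilon> where "\<epsilon> > 0" and max: "\<And>p. admissible t1 t2 \<tau> \<delta> qt2 g l p \<Longrightarrow>
        C1_norm_on {t1 - \<tau>..t2} (\<lambda>t. p t - q t) < \<epsilon> \<Longrightarrow>
        delayed_integral t1 t2 \<tau> L p \<le> delayed_integral t1 t2 \<tau> L q"
      unfolding local_maximizer_def by blast
    with near[OF \<open>\<epsilon> > 0\<close>, of 1] show False
      by (auto simp: sgn_if split: if_splits dest: max)
  qed
qed

section \<open>The Euler-Lagrange equations with time delay\<close>

text \<open>The interval is split at \<open>t2 - \<tau>\<close>, and the variations are taken with support in one of the two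
  parts. This produces one differential equation on each part and no condition linking the two.\<close>
lemma vanishing_first_variation_imp_Euler_Lagrange:
  fixes q :: "real \<Rightarrow> real ^ 'n::finite"
  assumes G: "C1_on G ({t1..t2} \<times> UNIV)" and q: "C2_on q {t1 - \<tau>..t2}"
    and zero: "\<And>h h'. variation_on t1 t2 h h' \<Longrightarrow> first_variation G q h h' = 0"
  shows "delayed_Euler_Lagrange t1 t2 \<tau> G q"
proof -
  define P2 where "P2 t = partial2 G (delayed t1 t2 \<tau> q t)" for t
  define P3 where "P3 t = partial3 G (delayed t1 t2 \<tau> q t)" for t
  define P4 where "P4 t = partial4 G (delayed t1 t2 \<tau> q t)" for t
  define P5 where "P5 t = partial5 G (delayed t1 t2 \<tau> q t)" for t
  note c = partials_delayed_continuous[OF G q, folded P2_def P3_def P4_def P5_def]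
  have cs: "continuous_on {c..d} P2" "continuous_on {c..d} P3"
    "continuous_on {c..d} (\<lambda>t. P4 (t + s))" "continuous_on {c..d} (\<lambda>t. P5 (t + s))"
    if "t1 \<le> c" "d + s \<le> t2" "0 \<le> s" for c d s
    using that
    by (auto intro!: continuous_on_subset[OF c(1)] continuous_on_subset[OF c(2)]
        continuous_on_compose2[OF c(3)] continuous_on_compose2[OF c(4)] continuous_intros)
  have fv: "first_variation G q h h' = i + j"
    if "((\<lambda>t. P2 t \<bullet> h t + P3 t \<bullet> h' t) has_integral i) {t1..t2}"
      "((\<lambda>t. P4 t \<bullet> h (t - \<tau>) + P5 t \<bullet> h' (t - \<tau>)) has_integral j) {t1..t2}" for h h' i j
    using integral_unique[OF has_integral_add[OF that]]
    by (simp add: first_variation_def P2_def P3_def P4_def P5_def add.assoc)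
  have left: "((\<lambda>s. P3 s + P5 (s + \<tau>)) has_vector_derivative P2 t + P4 (t + \<tau>)) (at t within {t1..t2 - \<tau>})"
    if t: "t \<in> {t1..t2 - \<tau>}" for t
  proof (rule du_Bois_Reymond[OF _ _ _ _ t])
    fix \<eta> \<eta>' :: "real \<Rightarrow> real" and v :: "real ^ 'n"
    assume "variation_on t1 (t2 - \<tau>) \<eta> \<eta>'"
    then have var: "variation_on t1 (t2 - \<tau>) (\<lambda>t. \<eta> t *\<^sub>R v) (\<lambda>t. \<eta>' t *\<^sub>R v)"
        "variation_on t1 t2 (\<lambda>t. \<eta> t *\<^sub>R v) (\<lambda>t. \<eta>' t *\<^sub>R v)"
      using tau_pos by (auto intro: variation_on_scaleR)
    define h where "h t = \<eta> t *\<^sub>R v" for t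
    define h' where "h' t = \<eta>' t *\<^sub>R v" for t
    have h: "variation_on t1 (t2 - \<tau>) h h'" and h2: "variation_on t1 t2 h h'"
      using var by (simp_all add: h_def[abs_def] h'_def[abs_def])
    have out: "h t = 0" "h' t = 0" if "t \<notin> {t1<..<t2 - \<tau>}" for t
      using h that by (auto simp: variation_on_def)
    note ch = variation_continuous[OF h]
    have i: "((\<lambda>t. P2 t \<bullet> h t + P3 t \<bullet> h' t) has_integral
        integral {t1..t2 - \<tau>} (\<lambda>t. P2 t \<bullet> h t + P3 t \<bullet> h' t)) {t1..t2 - \<tau>}"
      by (intro integrable_integral integrable_continuous_real continuous_intros cs[of _ _ 0] ch)
         (use tau_pos in auto)
    have j: "((\<lambda>t. P4 (t + \<tau>) \<bullet> h t + P5 (t + \<tau>) \<bullet> h' t) has_integral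
        integral {t1..t2 - \<tau>} (\<lambda>t. P4 (t + \<tau>) \<bullet> h t + P5 (t + \<tau>) \<bullet> h' t)) {t1..t2 - \<tau>}"
      by (intro integrable_integral integrable_continuous_real continuous_intros cs ch)
         (use tau_pos in auto)
    have i': "((\<lambda>t. P2 t \<bullet> h t + P3 t \<bullet> h' t) has_integral
        integral {t1..t2 - \<tau>} (\<lambda>t. P2 t \<bullet> h t + P3 t \<bullet> h' t)) {t1..t2}"
      by (rule has_integral_on_superset[OF i]) (use tau_pos out in auto)
    have "((\<lambda>t. P4 t \<bullet> h (t - \<tau>) + P5 t \<bullet> h' (t - \<tau>)) has_integral
        integral {t1..t2 - \<tau>} (\<lambda>t. P4 (t + \<tau>) \<bullet> h t + P5 (t + \<tau>) \<bullet> h' t)) {t1 + \<tau>..t2}"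
      \<comment> \<open>Substituting \<open>t + \<tau>\<close> for \<open>t\<close> moves the delay from the variation to the coefficients.\<close>
      using has_integral_shift_Icc_real[of "\<lambda>t. P4 t \<bullet> h (t - \<tau>) + P5 t \<bullet> h' (t - \<tau>)" \<tau> _ t1 "t2 - \<tau>"] j
      by (simp add: o_def add.commute)
    then have j': "((\<lambda>t. P4 t \<bullet> h (t - \<tau>) + P5 t \<bullet> h' (t - \<tau>)) has_integral
        integral {t1..t2 - \<tau>} (\<lambda>t. P4 (t + \<tau>) \<bullet> h t + P5 (t + \<tau>) \<bullet> h' t)) {t1..t2}"
      by (rule has_integral_on_superset) (use tau_pos out in auto)
    have "integral {t1..t2 - \<tau>} (\<lambda>t. (P2 t + P4 (t + \<tau>)) \<bullet> h t + (P3 t + P5 (t + \<tau>)) \<bullet> h' t) = 0"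
      using integral_unique[OF has_integral_add[OF i j]] fv[OF i' j'] zero[OF h2]
      by (simp add: inner_add_left algebra_simps)
    then show "integral {t1..t2 - \<tau>} (\<lambda>t. (P2 t + P4 (t + \<tau>)) \<bullet> (\<eta> t *\<^sub>R v) +
        (P3 t + P5 (t + \<tau>)) \<bullet> (\<eta>' t *\<^sub>R v)) = 0"
      unfolding h_def h'_def .
  qed (use tau_pos tau_less in \<open>auto intro!: continuous_intros cs\<close>)
  have right: "(P3 has_vector_derivative P2 t) (at t within {t2 - \<tau>..t2})"
    if t: "t \<in> {t2 - \<tau>..t2}" for t
  proof (rule du_Bois_Reymond[OF _ _ _ _ t])
    fix \<eta> \<eta>' :: "real \<Rightarrow> real" and v :: "real ^ 'n"
    assume "variation_on (t2 - \<tau>) t2 \<eta> \<eta>'"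
    then have var: "variation_on (t2 - \<tau>) t2 (\<lambda>t. \<eta> t *\<^sub>R v) (\<lambda>t. \<eta>' t *\<^sub>R v)"
        "variation_on t1 t2 (\<lambda>t. \<eta> t *\<^sub>R v) (\<lambda>t. \<eta>' t *\<^sub>R v)"
      using tau_less by (auto intro: variation_on_scaleR)
    define h where "h t = \<eta> t *\<^sub>R v" for t
    define h' where "h' t = \<eta>' t *\<^sub>R v" for t
    have h: "variation_on (t2 - \<tau>) t2 h h'" and h2: "variation_on t1 t2 h h'"
      using var by (simp_all add: h_def[abs_def] h'_def[abs_def])
    have out: "h t = 0" "h' t = 0" if "t \<notin> {t2 - \<tau><..<t2}" for t
      using h that by (auto simp: variation_on_def)
    have "((\<lambda>t. P2 t \<bullet> h t + P3 t \<bullet> h' t) has_integral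
        integral {t2 - \<tau>..t2} (\<lambda>t. P2 t \<bullet> h t + P3 t \<bullet> h' t)) {t2 - \<tau>..t2}"
      by (intro integrable_integral integrable_continuous_real continuous_intros cs[of _ _ 0]
          variation_continuous[OF h])
         (use tau_less in auto)
    then have i': "((\<lambda>t. P2 t \<bullet> h t + P3 t \<bullet> h' t) has_integral
        integral {t2 - \<tau>..t2} (\<lambda>t. P2 t \<bullet> h t + P3 t \<bullet> h' t)) {t1..t2}"
      by (rule has_integral_on_superset) (use tau_less out in auto)
    \<comment> \<open>For \<open>t \<le> t2\<close> the delayed time \<open>t - \<tau>\<close> lies to the left of the support.\<close>
    have j': "((\<lambda>t. P4 t \<bullet> h (t - \<tau>) + P5 t \<bullet> h' (t - \<tau>)) has_integral 0) {t1..t2}"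
      by (rule has_integral_is_0) (use out in auto)
    show "integral {t2 - \<tau>..t2} (\<lambda>t. P2 t \<bullet> (\<eta> t *\<^sub>R v) + P3 t \<bullet> (\<eta>' t *\<^sub>R v)) = 0"
      using fv[OF i' j'] zero[OF h2] unfolding h_def[symmetric] h'_def[symmetric] by simp
  qed (use tau_pos tau_less in \<open>auto intro!: cs[of _ _ 0]\<close>)
  have right': "(P3 has_vector_derivative P2 t) (at t within {t2 - \<tau><..t2})"
    if "t \<in> {t2 - \<tau><..t2}" for t
    by (rule has_vector_derivative_within_subset[OF right]) (use that in auto)
  show ?thesis
    using left right'
    unfolding delayed_Euler_Lagrange_def P2_def P3_def P4_def P5_def by blast
qed

end

theorem theorem3p4:
  fixes t1 t2 \<tau> l :: real
    and \<delta> q :: "real \<Rightarrow> real ^ 'n::finite"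
    and qt2 :: "real ^ 'n"
    and L g :: "'n args \<Rightarrow> real"
  assumes "t1 < t2" and "0 < \<tau>" and "\<tau> < t2 - t1"
    and "\<delta> piecewise_C1_differentiable_on {t1 - \<tau>..t1}"
    and "C1_on L ({t1..t2} \<times> UNIV)"
    and "C1_on g ({t1..t2} \<times> UNIV)"
    and "C2_on q {t1 - \<tau>..t2}"
    and "normal_extremizer t1 t2 \<tau> \<delta> qt2 L g l q"
  shows "\<exists>lam :: real. delayed_Euler_Lagrange t1 t2 \<tau> (\<lambda>x. L x - lam * g x) q"
proof -
  interpret delayed_interval t1 t2 \<tau> by unfold_locales fact+
  note L = assms(5) and g = assms(6) and q = assms(7)
  have ext: "extremizer t1 t2 \<tau> \<delta> qt2 L g l q"
    and "\<not> delayed_Euler_Lagrange t1 t2 \<tau> g q"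
    using assms(8) by (auto simp: normal_extremizer_def abnormal_extremizer_def)
  then obtain k k' where k: "variation_on t1 t2 k k'" and "first_variation g q k k' \<noteq> 0"
    using vanishing_first_variation_imp_Euler_Lagrange[OF g q] by blast
  define lam where "lam = first_variation L q k k' / first_variation g q k k'"
  have "first_variation (\<lambda>x. L x - lam * g x) q h h' = 0" if h: "variation_on t1 t2 h h'" for h h'
    using first_variations_proportional[OF L g ext h k] \<open>first_variation g q k k' \<noteq> 0\<close>
    unfolding first_variation_diff_mult[OF L g q h] by (simp add: lam_def field_simps)
  then have "delayed_Euler_Lagrange t1 t2 \<tau> (\<lambda>x. L x - lam * g x) q"
    by (intro vanishing_first_variation_imp_Euler_Lagrange C1_on_diff_mult L g q)
  then show ?thesis ..
qed

end
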